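(* Let $A_m\in\mathbf{U}_m$. The following are equivalent: (i) $A_m$ is an extreme point of $\mathbf{U}_m$; (ii) every entry $a_{ij}$ with $0<a_{ij}<1$ has at least one saturated neighborhood, and for any two different positions $(i,j)\neq(i',j')$ with $i\le j$, $i'\le j'$, $0<a_{ij}<1$ and $0<a_{i'j'}<1$, the minimal saturated neighborhoods of $a_{ij}$ and $a_{i'j'}$ do not coincide.
   Context: $I_m=\{1,\dots,m\}$. $\mathbf{U}_m$ is the set of real $m\times m$ matrices $A_m=(a_{ij})$ with $a_{ij}=a_{ji}\ge 0$ for all $i,j$ and $\sum_{i,j\in\alpha}a_{ij}\le|\alpha|$ for every $\alpha\subset I_m$ ($|\alpha|$ the cardinality); it is convex. For $\alpha\subset I_m$ the principal submatrix is $A_\alpha=(a_{ij})_{i,j\in\alpha}$. A nonempty $\alpha\subset I_m$ is saturated (for $A_m$) if $\sum_{i,j\in\alpha}a_{ij}=|\alpha|$, and $A_\alpha$ is then a saturated principal submatrix. A saturated neighborhood of the entry $a_{ij}$ is a saturated principal submatrix $A_\beta$ with $i,j\in\beta$; its radius is $|\beta|$; the minimal saturated neighborhood is the one of minimal radius (unique when it exists). Since $A_m$ is symmetric, $a_{ij}$ and $a_{ji}$ have the same saturated neighborhoods, so only positions with $i\le j$ are considered. *)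

theory Defs
  imports "HOL-Analysis.Analysis"
begin

text \<open>
  The index set \<open>I\<^sub>m = {1,\<dots>,m}\<close> is an arbitrary finite linearly ordered type \<open>'m\<close>
  with \<open>CARD('m) = m\<close>. A principal submatrix \<open>A\<^sub>\<alpha> = (a\<^sub>i\<^sub>j)\<^sub>i\<^sub>,\<^sub>j\<^sub>\<in>\<^sub>\<alpha>\<close> of a fixed matrix is
  represented by its index set \<open>\<alpha>\<close>.
\<close>

definition block_sum :: "real^'m^'m \<Rightarrow> 'm::finite set \<Rightarrow> real" where
  "block_sum A \<alpha> = (\<Sum>i\<in>\<alpha>. \<Sum>j\<in>\<alpha>. A $ i $ j)"

definition U_set :: "(real^'m^'m::finite) set" where
  "U_set = {A. (\<forall>i j. A $ i $ j = A $ j $ i \<and> 0 \<le> A $ i $ j) \<and>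
               (\<forall>\<alpha>. block_sum A \<alpha> \<le> real (card \<alpha>))}"

definition saturated :: "real^'m^'m \<Rightarrow> 'm::finite set \<Rightarrow> bool" where
  "saturated A \<alpha> \<longleftrightarrow> \<alpha> \<noteq> {} \<and> block_sum A \<alpha> = real (card \<alpha>)"

definition saturated_nbhd :: "real^'m^'m \<Rightarrow> 'm \<Rightarrow> 'm \<Rightarrow> 'm::finite set \<Rightarrow> bool" where
  "saturated_nbhd A i j \<beta> \<longleftrightarrow> saturated A \<beta> \<and> i \<in> \<beta> \<and> j \<in> \<beta>"

definition minimal_saturated_nbhd :: "real^'m^'m \<Rightarrow> 'm \<Rightarrow> 'm \<Rightarrow> 'm::finite set \<Rightarrow> bool" where
  "minimal_saturated_nbhd A i j \<beta> \<longleftrightarrow> is_arg_min card (saturated_nbhd A i j) \<beta>"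

end

theory Submission
  imports Defs
begin

text \<open>
  A matrix \<open>A\<close> of the polytope is extreme iff no nonzero symmetric \<open>D\<close> vanishes at the zeros of
  \<open>A\<close> and has block sum \<open>0\<close> on every saturated set. Since the entries are nonnegative, the block
  sum is supermodular, so saturated sets are closed under nonempty intersections and the minimal
  saturated neighborhood of a position is contained in all its other ones. If a fractional position
  has no saturated neighborhood, or two of them share the minimal one, a combination of one or two
  symmetric matrix units is such a \<open>D\<close>. Conversely, given such a \<open>D\<close>, take a position in its
  support whose minimal saturated neighborhood \<open>\<beta>\<close> is smallest: if the minimal neighborhoods are
  distinct, it is the only position of the support inside \<open>\<beta>\<close>, so the sum of \<open>D\<close> over \<open>\<beta>\<close> is
  not \<open>0\<close>.
\<close>

section \<open>Block sums, supermodularity and bounds on the entries\<close>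

lemma block_sum_add: "block_sum (A + B) \<alpha> = block_sum A \<alpha> + block_sum B \<alpha>"
  by (simp add: block_sum_def sum.distrib)

lemma block_sum_diff: "block_sum (A - B) \<alpha> = block_sum A \<alpha> - block_sum B \<alpha>"
  by (simp add: block_sum_def sum_subtractf)

lemma block_sum_scaleR: "block_sum (c *\<^sub>R A) \<alpha> = c * block_sum A \<alpha>"
  by (simp add: block_sum_def sum_distrib_left)

lemma block_sum_empty: "block_sum A {} = 0"
  by (simp add: block_sum_def)

lemma block_sum_Times: "block_sum A \<alpha> = (\<Sum>p\<in>\<alpha> \<times> \<alpha>. A $ fst p $ snd p)"
  by (simp add: block_sum_def sum.cartesian_product case_prod_beta)

text \<open>The squares of the two index sets meet in the square of the intersection, and their
  union lies in the square of the union; the positions left over have nonnegative entries.\<close>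

lemma block_sum_supermodular:
  assumes "\<And>i j. 0 \<le> A $ i $ j"
  shows "block_sum A \<alpha> + block_sum A \<beta> \<le> block_sum A (\<alpha> \<union> \<beta>) + block_sum A (\<alpha> \<inter> \<beta>)"
proof -
  let ?f = "\<lambda>p. A $ fst p $ snd p"
  have "sum ?f (\<alpha> \<times> \<alpha>) + sum ?f (\<beta> \<times> \<beta>) =
      sum ?f (\<alpha> \<times> \<alpha> \<union> \<beta> \<times> \<beta>) + sum ?f ((\<alpha> \<times> \<alpha>) \<inter> (\<beta> \<times> \<beta>))"
    by (rule sum.union_inter [symmetric]) auto
  moreover have "(\<alpha> \<times> \<alpha>) \<inter> (\<beta> \<times> \<beta>) = (\<alpha> \<inter> \<beta>) \<times> (\<alpha> \<inter> \<beta>)"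
    by auto
  moreover have "sum ?f (\<alpha> \<times> \<alpha> \<union> \<beta> \<times> \<beta>) \<le> sum ?f ((\<alpha> \<union> \<beta>) \<times> (\<alpha> \<union> \<beta>))"
    by (rule sum_mono2) (auto simp: assms)
  ultimately show ?thesis
    by (simp add: block_sum_Times)
qed

lemma U_set_nonneg: "A \<in> U_set \<Longrightarrow> 0 \<le> A $ i $ j"
  and U_set_sym: "A \<in> U_set \<Longrightarrow> A $ i $ j = A $ j $ i"
  and U_set_block_sum_le: "A \<in> U_set \<Longrightarrow> block_sum A \<alpha> \<le> real (card \<alpha>)"
  by (auto simp: U_set_def)

lemma U_set_diag_le_1: "A \<in> U_set \<Longrightarrow> A $ i $ i \<le> 1"
  using U_set_block_sum_le[of A "{i}"] by (simp add: block_sum_def)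

lemma U_set_pair_le:
  assumes "A \<in> U_set" "i \<noteq> j"
  shows "A $ i $ i + A $ j $ j + 2 * A $ i $ j \<le> 2"
  using U_set_block_sum_le[of A "{i, j}"] U_set_sym[of A j i] assms by (simp add: block_sum_def)

lemma U_set_le_1:
  assumes "A \<in> U_set"
  shows "A $ i $ j \<le> 1"
  using U_set_pair_le[OF assms, of i j] U_set_nonneg[OF assms] U_set_diag_le_1[OF assms]
  by (cases "i = j") (auto, smt (verit))

section \<open>Saturated sets and minimal neighborhoods\<close>

lemma saturated_Int:
  assumes "A \<in> U_set" "saturated A \<alpha>" "saturated A \<beta>" "\<alpha> \<inter> \<beta> \<noteq> {}"
  shows "saturated A (\<alpha> \<inter> \<beta>)"
proof -
  have "card \<alpha> + card \<beta> = card (\<alpha> \<union> \<beta>) + card (\<alpha> \<inter> \<beta>)"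
    by (rule card_Un_Int) auto
  then have "real (card \<alpha>) + real (card \<beta>) = real (card (\<alpha> \<union> \<beta>)) + real (card (\<alpha> \<inter> \<beta>))"
    by linarith
  \<comment> \<open>Supermodularity and the bounds for union and intersection form a chain whose two
    ends agree, so both bounds are attained.\<close>
  then show ?thesis
    using block_sum_supermodular[of A \<alpha> \<beta>] U_set_nonneg[OF assms(1)] assms
      U_set_block_sum_le[OF assms(1), of "\<alpha> \<union> \<beta>"] U_set_block_sum_le[OF assms(1), of "\<alpha> \<inter> \<beta>"]
    by (auto simp: saturated_def)
qed

lemma minimal_saturated_nbhdD: "minimal_saturated_nbhd A i j \<beta> \<Longrightarrow> saturated_nbhd A i j \<beta>"
  by (simp add: minimal_saturated_nbhd_def is_arg_min_def)

lemma minimal_saturated_nbhd_exists: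
  assumes "saturated_nbhd A i j \<beta>"
  obtains \<gamma> where "minimal_saturated_nbhd A i j \<gamma>"
  using ex_has_least_nat[of "saturated_nbhd A i j" \<beta> card] assms
  by (auto simp: minimal_saturated_nbhd_def is_arg_min_linorder)

text \<open>Intersecting with another neighborhood gives a neighborhood again, and minimality of the
  radius forbids it to be smaller.\<close>

lemma minimal_saturated_nbhd_subset:
  assumes "A \<in> U_set" "minimal_saturated_nbhd A i j \<beta>" "saturated_nbhd A i j \<gamma>"
  shows "\<beta> \<subseteq> \<gamma>"
proof -
  have "saturated_nbhd A i j (\<beta> \<inter> \<gamma>)"
    using saturated_Int[OF assms(1)] minimal_saturated_nbhdD[OF assms(2)] assms(3)
    unfolding saturated_nbhd_def by blast
  then have "card \<beta> \<le> card (\<beta> \<inter> \<gamma>)"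
    using assms(2) by (simp add: minimal_saturated_nbhd_def is_arg_min_linorder)
  then have "\<beta> \<inter> \<gamma> = \<beta>"
    by (intro card_seteq) auto
  then show ?thesis
    by blast
qed

lemma minimal_saturated_nbhd_commute:
  "minimal_saturated_nbhd A i j \<beta> \<longleftrightarrow> minimal_saturated_nbhd A j i \<beta>"
proof -
  have "saturated_nbhd A i j = saturated_nbhd A j i"
    by (auto simp: saturated_nbhd_def fun_eq_iff)
  then show ?thesis
    by (simp add: minimal_saturated_nbhd_def)
qed

section \<open>Extreme points and directions that respect the tight constraints\<close>

lemma eventually_at_right_mult_le:
  fixes a b :: real
  assumes "0 \<le> b" "b = 0 \<Longrightarrow> a = 0"
  shows "eventually (\<lambda>e. e * a \<le> b) (at_right 0)"
proof (cases "b = 0")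
  case False
  have "((\<lambda>e. e * a) \<longlongrightarrow> 0 * a) (at_right 0)"
    by (intro tendsto_intros)
  then have "eventually (\<lambda>e. e * a < b) (at_right 0)"
    by (rule order_tendstoD) (use False assms in auto)
  then show ?thesis
    by eventually_elim simp
qed (use assms in simp)

text \<open>Constraints that are tight at \<open>A\<close> do not change along \<open>D\<close>, the
  others tolerate a small step, and there are only finitely many of them.\<close>

lemma U_set_perturb:
  assumes A: "A \<in> U_set"
    and sym: "\<And>i j. D $ i $ j = D $ j $ i"
    and zero: "\<And>i j. A $ i $ j = 0 \<Longrightarrow> D $ i $ j = 0"
    and sat: "\<And>\<alpha>. saturated A \<alpha> \<Longrightarrow> block_sum D \<alpha> = 0"
  shows "eventually (\<lambda>e. A + e *\<^sub>R D \<in> U_set) (at_right 0)"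
proof -
  have "eventually (\<lambda>e. e * - (D $ i $ j) \<le> A $ i $ j) (at_right 0)" for i j
    by (intro eventually_at_right_mult_le) (auto simp: U_set_nonneg[OF A] zero)
  then have "eventually (\<lambda>e. \<forall>i j. e * - (D $ i $ j) \<le> A $ i $ j) (at_right 0)"
    by (intro eventually_all_finite)
  moreover have "eventually (\<lambda>e. e * block_sum D \<alpha> \<le> card \<alpha> - block_sum A \<alpha>) (at_right 0)" for \<alpha>
  proof (intro eventually_at_right_mult_le)
    \<comment> \<open>The empty set is tight without being saturated, but its block sum is always
      0.\<close>
    assume "card \<alpha> - block_sum A \<alpha> = 0"
    then show "block_sum D \<alpha> = 0"
      by (cases "\<alpha> = {}") (auto simp: block_sum_empty saturated_def intro: sat)
  qed (simp add: U_set_block_sum_le[OF A])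
  then have "eventually (\<lambda>e. \<forall>\<alpha>. e * block_sum D \<alpha> \<le> card \<alpha> - block_sum A \<alpha>) (at_right 0)"
    by (intro eventually_all_finite)
  ultimately show ?thesis
  proof eventually_elim
    case (elim e)
    have "0 \<le> A $ i $ j + e * D $ i $ j" for i j
      using elim(1)[rule_format, of i j] by simp
    moreover have "block_sum A \<alpha> + e * block_sum D \<alpha> \<le> card \<alpha>" for \<alpha>
      using elim(2)[rule_format, of \<alpha>] by simp
    moreover have "A $ i $ j + e * D $ i $ j = A $ j $ i + e * D $ j $ i" for i j
      using U_set_sym[OF A, of i j] sym[of i j] by simp
    ultimately show ?case
      by (simp add: U_set_def block_sum_add block_sum_scaleR)
  qed
qed

text \<open>Small steps along \<open>D\<close> and \<open>- D\<close> both stay in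
  \<open>U_set\<close>, so a nonzero \<open>D\<close> would make \<open>A\<close> the midpoint of
  two different members.\<close>

lemma extreme_point_U_setD:
  assumes ext: "A extreme_point_of U_set"
    and sym: "\<And>i j. D $ i $ j = D $ j $ i"
    and zero: "\<And>i j. A $ i $ j = 0 \<Longrightarrow> D $ i $ j = 0"
    and sat: "\<And>\<alpha>. saturated A \<alpha> \<Longrightarrow> block_sum D \<alpha> = 0"
  shows "D = 0"
proof (rule ccontr)
  assume "D \<noteq> 0"
  have A: "A \<in> U_set"
    using ext by (simp add: extreme_point_of_def)
  have neg: "block_sum (- D) \<alpha> = - block_sum D \<alpha>" for \<alpha>
    using block_sum_scaleR[of "-1" D \<alpha>] by simp
  have "eventually (\<lambda>e. A + e *\<^sub>R D \<in> U_set) (at_right 0)"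
    by (rule U_set_perturb[OF A]) (auto simp: sym zero sat)
  moreover have "eventually (\<lambda>e. A + e *\<^sub>R (- D) \<in> U_set) (at_right 0)"
  proof (rule U_set_perturb[OF A])
    show "(- D) $ i $ j = (- D) $ j $ i" for i j
      using sym[of i j] by simp
  qed (auto simp: zero sat neg)
  moreover have "eventually (\<lambda>e::real. 0 < e) (at_right 0)"
    by (rule eventually_at_right_less)
  ultimately have "eventually (\<lambda>e. A + e *\<^sub>R D \<in> U_set \<and> A + e *\<^sub>R (- D) \<in> U_set \<and> 0 < e)
      (at_right 0)"
    by eventually_elim simp
  then obtain e where e: "A + e *\<^sub>R D \<in> U_set" "A + e *\<^sub>R (- D) \<in> U_set" "0 < e"
    by (auto dest!: eventually_happens)
  have "midpoint (A + e *\<^sub>R D) (A + e *\<^sub>R (- D)) = A"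
    by (simp add: midpoint_def scaleR_2 [symmetric])
  moreover have "A + e *\<^sub>R D \<noteq> A + e *\<^sub>R (- D)"
  proof
    assume "A + e *\<^sub>R D = A + e *\<^sub>R (- D)"
    then have "(2 * e) *\<^sub>R D = 0"
      by (simp add: scaleR_2 [symmetric] eq_neg_iff_add_eq_0 flip: scaleR_scaleR)
    then show False
      using \<open>D \<noteq> 0\<close> e(3) by simp
  qed
  ultimately have "A \<in> open_segment (A + e *\<^sub>R D) (A + e *\<^sub>R (- D))"
    using midpoint_in_open_segment by metis
  then show False
    using ext e(1,2) by (auto simp: extreme_point_of_def)
qed

lemma convex_combination_eq_boundD:
  fixes x y c u :: real
  assumes "0 < u" "u < 1" "x \<le> c" "y \<le> c" "(1 - u) * x + u * y = c"
  shows "x = c \<and> y = c"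
proof -
  have "(1 - u) * (c - x) + u * (c - y) = 0"
    using assms(5) by (simp add: algebra_simps)
  moreover have "0 \<le> (1 - u) * (c - x)" "0 \<le> u * (c - y)"
    using assms by auto
  ultimately have "(1 - u) * (c - x) = 0" "u * (c - y) = 0"
    by linarith+
  then show ?thesis
    using assms by simp
qed

text \<open>A constraint that is tight strictly between \<open>B\<close> and \<open>C\<close> is
  tight at both ends, so \<open>rigid\<close> applies to \<open>C - B\<close>.\<close>

lemma extreme_point_U_setI:
  assumes A: "A \<in> U_set"
    and rigid: "\<And>D. \<lbrakk>\<And>i j. D $ i $ j = D $ j $ i; \<And>i j. A $ i $ j = 0 \<Longrightarrow> D $ i $ j = 0;
        \<And>\<alpha>. saturated A \<alpha> \<Longrightarrow> block_sum D \<alpha> = 0\<rbrakk> \<Longrightarrow> D = 0"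
  shows "A extreme_point_of U_set"
  unfolding extreme_point_of_def
proof (intro conjI ballI notI)
  fix B C assume B: "B \<in> U_set" and C: "C \<in> U_set" and seg: "A \<in> open_segment B C"
  obtain u where "B \<noteq> C" and u: "0 < u" "u < 1" and Au: "A = (1 - u) *\<^sub>R B + u *\<^sub>R C"
    using seg by (auto simp: in_segment)
  have "C - B = 0"
  proof (rule rigid)
    fix i j
    show "(C - B) $ i $ j = (C - B) $ j $ i"
      using U_set_sym[OF B, of i j] U_set_sym[OF C, of i j] by simp
    show "(C - B) $ i $ j = 0" if "A $ i $ j = 0"
      \<comment> \<open>The entries are negated to turn nonnegativity into the upper bound
        0.\<close>
      using convex_combination_eq_boundD[OF u, of "- B $ i $ j" 0 "- C $ i $ j"] that
        U_set_nonneg[OF B] U_set_nonneg[OF C] by (simp add: Au)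
  next
    fix \<alpha> assume "saturated A \<alpha>"
    then show "block_sum (C - B) \<alpha> = 0"
      using convex_combination_eq_boundD[OF u, of "block_sum B \<alpha>" "card \<alpha>" "block_sum C \<alpha>"]
        U_set_block_sum_le[OF B] U_set_block_sum_le[OF C]
      by (simp add: saturated_def Au block_sum_add block_sum_diff block_sum_scaleR)
  qed
  then show False
    using \<open>B \<noteq> C\<close> by simp
qed (rule A)

section \<open>Symmetric matrix units and entries equal to 1\<close>

definition sym_unit :: "'m::finite \<Rightarrow> 'm \<Rightarrow> real^'m^'m" where
  "sym_unit i j = (\<chi> k l. if (k, l) \<in> {(i, j), (j, i)} then 1 else 0)"

lemma sym_unit_nth: "sym_unit i j $ k $ l = (if (k, l) \<in> {(i, j), (j, i)} then 1 else 0)"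
  by (simp add: sym_unit_def)

lemma sym_unit_sym: "sym_unit i j $ k $ l = sym_unit i j $ l $ k"
  by (auto simp: sym_unit_nth)

text \<open>The cardinality is 1 on the diagonal and 2 off it, which treats both cases at
  once.\<close>

lemma block_sum_two_positions:
  assumes "\<And>k l. (k, l) \<in> \<alpha> \<times> \<alpha> \<Longrightarrow> (k, l) \<notin> {(i, j), (j, i)} \<Longrightarrow> D $ k $ l = 0"
    and "D $ i $ j = D $ j $ i"
  shows "block_sum D \<alpha> = (if i \<in> \<alpha> \<and> j \<in> \<alpha> then real (card {(i, j), (j, i)}) * D $ i $ j else 0)"
proof -
  have "block_sum D \<alpha> = (\<Sum>p \<in> (\<alpha> \<times> \<alpha>) \<inter> {(i, j), (j, i)}. D $ fst p $ snd p)"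
    unfolding block_sum_Times
  proof (rule sum.mono_neutral_right)
    show "\<forall>p \<in> \<alpha> \<times> \<alpha> - (\<alpha> \<times> \<alpha>) \<inter> {(i, j), (j, i)}. D $ fst p $ snd p = 0"
    proof
      fix p assume "p \<in> \<alpha> \<times> \<alpha> - (\<alpha> \<times> \<alpha>) \<inter> {(i, j), (j, i)}"
      then show "D $ fst p $ snd p = 0"
        using assms(1)[of "fst p" "snd p"] by auto
    qed
  qed auto
  also have "\<dots> = (\<Sum>p \<in> (\<alpha> \<times> \<alpha>) \<inter> {(i, j), (j, i)}. D $ i $ j)"
    by (rule sum.cong) (use assms(2) in auto)
  also have "\<dots> = real (card ((\<alpha> \<times> \<alpha>) \<inter> {(i, j), (j, i)})) * D $ i $ j"
    by simp
  also have "(\<alpha> \<times> \<alpha>) \<inter> {(i, j), (j, i)} = (if i \<in> \<alpha> \<and> j \<in> \<alpha> then {(i, j), (j, i)} else {})"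
    by auto
  finally show ?thesis
    by simp
qed

lemma block_sum_sym_unit:
  "block_sum (sym_unit i j) \<alpha> = (if i \<in> \<alpha> \<and> j \<in> \<alpha> then real (card {(i, j), (j, i)}) else 0)"
  by (subst block_sum_two_positions[where i = i and j = j]) (auto simp: sym_unit_nth)

text \<open>A diagonal entry 1 saturates its singleton. An off-diagonal entry 1 forces both diagonal
  entries to be 0, so the pair is saturated and the block sum of \<open>D\<close> on it is twice the
  entry in question.\<close>

lemma U_set_direction_eq_0_at_1:
  assumes A: "A \<in> U_set"
    and sym: "\<And>i j. D $ i $ j = D $ j $ i"
    and zero: "\<And>i j. A $ i $ j = 0 \<Longrightarrow> D $ i $ j = 0"
    and sat: "\<And>\<alpha>. saturated A \<alpha> \<Longrightarrow> block_sum D \<alpha> = 0"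
    and 1: "A $ i $ j = 1"
  shows "D $ i $ j = 0"
proof (cases "i = j")
  case True
  then have "saturated A {i}"
    using 1 by (simp add: saturated_def block_sum_def)
  then show ?thesis
    using sat True by (fastforce simp: block_sum_def)
next
  case False
  have "A $ i $ i = 0" "A $ j $ j = 0"
    using U_set_pair_le[OF A False] U_set_nonneg[OF A, of i i] U_set_nonneg[OF A, of j j] 1
    by linarith+
  moreover from this have "saturated A {i, j}"
    using 1 U_set_sym[OF A, of i j] False by (simp add: saturated_def block_sum_def)
  ultimately show ?thesis
    using sat[of "{i, j}"] zero[of i i] zero[of j j] sym[of i j] False
    by (simp add: block_sum_def)
qed

section \<open>Extremality in terms of minimal saturated neighborhoods\<close>

theorem theorem2p13:
  fixes A :: "real^('m::{finite,linorder})^('m::{finite,linorder})"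
  assumes "A \<in> U_set"
  shows "A extreme_point_of U_set \<longleftrightarrow>
    (\<forall>i j. 0 < A $ i $ j \<and> A $ i $ j < 1 \<longrightarrow> (\<exists>\<beta>. saturated_nbhd A i j \<beta>)) \<and>
    (\<forall>i j i' j'. (i, j) \<noteq> (i', j') \<and> i \<le> j \<and> i' \<le> j' \<and>
        0 < A $ i $ j \<and> A $ i $ j < 1 \<and> 0 < A $ i' $ j' \<and> A $ i' $ j' < 1 \<longrightarrow>
        (\<forall>\<beta> \<beta>'. minimal_saturated_nbhd A i j \<beta> \<and> minimal_saturated_nbhd A i' j' \<beta>' \<longrightarrow>
           \<beta> \<noteq> \<beta>'))"
    (is "_ \<longleftrightarrow> ?nbhd \<and> ?distinct")
proof
  assume ext: "A extreme_point_of U_set"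
  show "?nbhd \<and> ?distinct"
  proof (intro conjI allI impI notI)
    fix i j assume pos: "0 < A $ i $ j \<and> A $ i $ j < 1"
    show "\<exists>\<beta>. saturated_nbhd A i j \<beta>"
    proof (rule ccontr)
      assume none: "\<nexists>\<beta>. saturated_nbhd A i j \<beta>"
      have "sym_unit i j = 0"
      proof (rule extreme_point_U_setD[OF ext])
        show "sym_unit i j $ k $ l = 0" if "A $ k $ l = 0" for k l
          using that pos U_set_sym[OF assms, of i j] by (auto simp: sym_unit_nth)
        show "block_sum (sym_unit i j) \<alpha> = 0" if "saturated A \<alpha>" for \<alpha>
          using that none by (auto simp: block_sum_sym_unit saturated_nbhd_def)
      qed (auto simp: sym_unit_nth)
      then have "sym_unit i j $ i $ j = 0"
        by simp
      then show False
        by (simp add: sym_unit_nth)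
    qed
  next
    fix i j i' j' \<beta> \<beta>'
    assume pos: "(i, j) \<noteq> (i', j') \<and> i \<le> j \<and> i' \<le> j' \<and>
        0 < A $ i $ j \<and> A $ i $ j < 1 \<and> 0 < A $ i' $ j' \<and> A $ i' $ j' < 1"
      and min: "minimal_saturated_nbhd A i j \<beta> \<and> minimal_saturated_nbhd A i' j' \<beta>'"
      and eq: "\<beta> = \<beta>'"
    \<comment> \<open>A saturated set containing one of the positions includes the shared minimal
      neighborhood, hence contains the other position.\<close>
    have iff: "i \<in> \<alpha> \<and> j \<in> \<alpha> \<longleftrightarrow> i' \<in> \<alpha> \<and> j' \<in> \<alpha>" if "saturated A \<alpha>" for \<alpha>
      using that min eq minimal_saturated_nbhdD[of A i j] minimal_saturated_nbhdD[of A i' j']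
        minimal_saturated_nbhd_subset[OF assms, of i j \<beta> \<alpha>]
        minimal_saturated_nbhd_subset[OF assms, of i' j' \<beta> \<alpha>]
      unfolding saturated_nbhd_def by blast
    define c where "c = real (card {(i, j), (j, i)})"
    define c' where "c' = real (card {(i', j'), (j', i')})"
    have "c' \<noteq> 0"
      by (simp add: c'_def)
    \<comment> \<open>The weights are crossed so that the two block sums cancel on every saturated
      set.\<close>
    let ?D = "c' *\<^sub>R sym_unit i j - c *\<^sub>R sym_unit i' j'"
    have "?D = 0"
    proof (rule extreme_point_U_setD[OF ext])
      show "?D $ k $ l = 0" if "A $ k $ l = 0" for k l
      proof -
        have "(k, l) \<notin> {(i, j), (j, i)}" "(k, l) \<notin> {(i', j'), (j', i')}"
          using that pos U_set_sym[OF assms, of k l] by auto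
        then have "sym_unit i j $ k $ l = 0" "sym_unit i' j' $ k $ l = 0"
          by (simp_all only: sym_unit_nth if_False)
        then show ?thesis
          by simp
      qed
      show "block_sum ?D \<alpha> = 0" if "saturated A \<alpha>" for \<alpha>
        using iff[OF that]
        by (auto simp: block_sum_diff block_sum_scaleR block_sum_sym_unit c_def c'_def)
      show "?D $ k $ l = ?D $ l $ k" for k l
        by (simp add: sym_unit_sym[of _ _ k l])
    qed
    moreover have "?D $ i $ j = c'"
    proof -
      \<comment> \<open>The two positions are not transposes of each other either: with both
        ordered, that would force all four indices to be equal.\<close>
      have "(i, j) \<notin> {(i', j'), (j', i')}"
        using pos by auto
      then have "sym_unit i' j' $ i $ j = 0"
        by (simp only: sym_unit_nth if_False)
      then show ?thesis
        by (simp add: sym_unit_nth[of i j])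
    qed
    ultimately show False
      using \<open>c' \<noteq> 0\<close> by simp
  qed
next
  assume "?nbhd \<and> ?distinct"
  then have nbhd: ?nbhd and "?distinct"
    by blast+
  \<comment> \<open>The hypothesis concerns ordered positions; for arbitrary ones it holds up to
    transposition.\<close>
  have distinct: "(k, l) \<in> {(i, j), (j, i)}"
    if "0 < A $ i $ j" "A $ i $ j < 1" "0 < A $ k $ l" "A $ k $ l < 1"
      "minimal_saturated_nbhd A i j \<beta>" "minimal_saturated_nbhd A k l \<beta>" for i j k l \<beta>
  proof -
    have ordered: "(min i j, max i j) = (min k l, max k l)"
    proof (rule ccontr)
      have m: "A $ min i j $ max i j = A $ i $ j" "A $ min k l $ max k l = A $ k $ l"
        by (auto simp: min_def max_def intro: U_set_sym[OF assms])
      have "minimal_saturated_nbhd A (min i j) (max i j) \<beta>"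
        "minimal_saturated_nbhd A (min k l) (max k l) \<beta>"
        using that(5,6) minimal_saturated_nbhd_commute by (auto simp: min_def max_def)
      moreover assume "(min i j, max i j) \<noteq> (min k l, max k l)"
      ultimately show False
        using \<open>?distinct\<close>[rule_format, of "min i j" "max i j" "min k l" "max k l" \<beta> \<beta>] that(1-4)
        unfolding m by (simp add: min.coboundedI1)
    qed
    then show ?thesis
      by (auto simp: min_def max_def split: if_splits)
  qed
  show "A extreme_point_of U_set"
  proof (rule extreme_point_U_setI[OF assms], rule ccontr)
    fix D
    assume sym: "\<And>i j. D $ i $ j = D $ j $ i"
      and zero: "\<And>i j. A $ i $ j = 0 \<Longrightarrow> D $ i $ j = 0"
      and sat: "\<And>\<alpha>. saturated A \<alpha> \<Longrightarrow> block_sum D \<alpha> = 0"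
      and "D \<noteq> 0"
    \<comment> \<open>Entries 0 and 1 of \<open>A\<close> are excluded from the support of
      \<open>D\<close>, so \<open>nbhd\<close> and \<open>distinct\<close> apply there.\<close>
    have frac: "0 < A $ i $ j" "A $ i $ j < 1" if "D $ i $ j \<noteq> 0" for i j
      using that zero[of i j] U_set_direction_eq_0_at_1[OF assms sym zero sat, of i j]
        U_set_nonneg[OF assms, of i j] U_set_le_1[OF assms, of i j] by linarith+
    define P where "P \<beta> \<longleftrightarrow> (\<exists>i j. D $ i $ j \<noteq> 0 \<and> minimal_saturated_nbhd A i j \<beta>)" for \<beta>
    obtain i\<^sub>0 j\<^sub>0 where "D $ i\<^sub>0 $ j\<^sub>0 \<noteq> 0"
      using \<open>D \<noteq> 0\<close> by (auto simp: vec_eq_iff)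
    then obtain \<beta>\<^sub>0 where "P \<beta>\<^sub>0"
      unfolding P_def using nbhd frac minimal_saturated_nbhd_exists by metis
    then obtain \<beta> where "P \<beta>" and least: "\<And>\<gamma>. P \<gamma> \<Longrightarrow> card \<beta> \<le> card \<gamma>"
      using ex_has_least_nat[of P \<beta>\<^sub>0 card] by auto
    then obtain i j where nz: "D $ i $ j \<noteq> 0" and min: "minimal_saturated_nbhd A i j \<beta>"
      by (auto simp: P_def)
    have \<beta>: "saturated A \<beta>" "i \<in> \<beta>" "j \<in> \<beta>"
      using minimal_saturated_nbhdD[OF min] by (auto simp: saturated_nbhd_def)
    have "block_sum D \<beta> =
        (if i \<in> \<beta> \<and> j \<in> \<beta> then real (card {(i, j), (j, i)}) * D $ i $ j else 0)"
    proof (rule block_sum_two_positions)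
      fix k l assume kl: "(k, l) \<in> \<beta> \<times> \<beta>" "(k, l) \<notin> {(i, j), (j, i)}"
      show "D $ k $ l = 0"
      proof (rule ccontr)
        assume nz': "D $ k $ l \<noteq> 0"
        have "saturated_nbhd A k l \<beta>"
          using \<beta> kl by (simp add: saturated_nbhd_def)
        then obtain \<gamma> where \<gamma>: "minimal_saturated_nbhd A k l \<gamma>" and "\<gamma> \<subseteq> \<beta>"
          using minimal_saturated_nbhd_exists minimal_saturated_nbhd_subset[OF assms] by metis
        \<comment> \<open>The choice of \<beta> leaves no room for a smaller neighborhood, so
          \<gamma> equals \<beta>, which \<open>distinct\<close> rules out.\<close>
        moreover have "card \<beta> \<le> card \<gamma>"
          using least nz' \<gamma> by (auto simp: P_def)
        ultimately have "\<gamma> = \<beta>"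
          by (intro card_seteq) auto
        then show False
          using distinct[OF frac[OF nz] frac[OF nz'] min] \<gamma> kl by simp
      qed
    qed (rule sym)
    \<comment> \<open>The block sum over \<beta> is one or two times a nonzero entry, yet \<beta> is
      saturated.\<close>
    then show False
      using sat[OF \<beta>(1)] \<beta> nz by simp
  qed
qed

end
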